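(* Let \[ A=\sqrt{\frac{\sqrt{70+2\sqrt5}-8}{1+\sqrt5}},\qquad B=\sqrt{\frac{\sqrt{70-2\sqrt5}-8}{1-\sqrt5}}. \] Then for every integer $s$: \[ \sum_{n=0}^\infty \frac{(-1)^nL_{2n+s}}{(2n+1)^2}\binom{4n+2}{2n+1}^{-1} = 4\left(\alpha^{s-1}\arctan A\,\operatorname{arctanh}A + \beta^{s-1}\arctan B\,\operatorname{arctanh}B\right), \] \[ \sum_{n=0}^\infty \frac{(-1)^nF_{2n+s}}{(2n+1)^2}\binom{4n+2}{2n+1}^{-1} = \frac{4}{\sqrt5}\left(\alpha^{s-1}\arctan A\,\operatorname{arctanh}A - \beta^{s-1}\arctan B\,\operatorname{arctanh}B\right), \] \[ \begin{aligned} \sum_{n=0}^\infty \frac{(-1)^nL_{2n+s}}{2n+1}\binom{4n+2}{2n+1}^{-1} &= 2A\alpha^{s-1}\frac{1-A^4}{1+A^4}\left(\frac{\operatorname{arctanh}A}{1+A^2}+\frac{\arctan A}{1-A^2}\right)\\ &\quad + 2B\beta^{s-1}\frac{1-B^4}{1+B^4}\left(\frac{\operatorname{arctanh}B}{1+B^2}+\frac{\arctan B}{1-B^2}\right), \end{aligned} \] \[ \begin{aligned} \sum_{n=0}^\infty \frac{(-1)^nF_{2n+s}}{2n+1}\binom{4n+2}{2n+1}^{-1} &= \frac{2A\alpha^{s-1}}{\sqrt5}\frac{1-A^4}{1+A^4}\left(\frac{\operatorname{arctanh}A}{1+A^2}+\frac{\arctan A}{1-A^2}\right)\\ &\quad -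 \frac{2B\beta^{s-1}}{\sqrt5}\frac{1-B^4}{1+B^4}\left(\frac{\operatorname{arctanh}B}{1+B^2}+\frac{\arctan B}{1-B^2}\right), \end{aligned} \] \[ \begin{aligned} \sum_{n=0}^\infty (-1)^n\binom{4n+2}{2n+1}^{-1}L_{2n+s} &= \frac{2A^2(1-A^4)}{(1+A^4)^2}\alpha^{s-1} + \frac{2B^2(1-B^4)}{(1+B^4)^2}\beta^{s-1}\\ &\quad + A\alpha^{s-1}\frac{(1+A^2)(1-A^2)^2(A^4+4A^2+1)}{(1+A^4)^3}\arctan A\\ &\quad + B\beta^{s-1}\frac{(1+B^2)(1-B^2)^2(B^4+4B^2+1)}{(1+B^4)^3}\arctan B\\ &\quad + A\alpha^{s-1}\frac{(1-A^2)(1+A^2)^2(A^4-4A^2+1)}{(1+A^4)^3}\operatorname{arctanh}A\\ &\quad + B\beta^{s-1}\frac{(1-B^2)(1+B^2)^2(B^4-4B^2+1)}{(1+B^4)^3}\operatorname{arctanh}B, \end{aligned} \] and \[ \begin{aligned} \sqrt5\sum_{n=0}^\infty (-1)^n\binom{4n+2}{2n+1}^{-1}F_{2n+s} &= \frac{2A^2(1-A^4)}{(1+A^4)^2}\alpha^{s-1} - \frac{2B^2(1-B^4)}{(1+B^4)^2}\beta^{s-1}\\ &\quad + A\alpha^{s-1}\frac{(1+A^2)(1-A^2)^2(A^4+4A^2+1)}{(1+A^4)^3}\arctan A\\ &\quad - B\beta^{s-1}\frac{(1+B^2)(1-B^2)^2(B^4+4B^2+1)}{(1+B^4)^3}\arctan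 B\\ &\quad + A\alpha^{s-1}\frac{(1-A^2)(1+A^2)^2(A^4-4A^2+1)}{(1+A^4)^3}\operatorname{arctanh}A\\ &\quad - B\beta^{s-1}\frac{(1-B^2)(1+B^2)^2(B^4-4B^2+1)}{(1+B^4)^3}\operatorname{arctanh}B. \end{aligned} \]
   Context: $\alpha=(1+\sqrt5)/2$ and $\beta=(1-\sqrt5)/2=-1/\alpha$. $F_n$ and $L_n$ are the Fibonacci and Lucas numbers for $n\in\mathbb{Z}$, given by $F_n=(\alpha^n-\beta^n)/\sqrt5$ and $L_n=\alpha^n+\beta^n$ (equivalently $F_0=0,F_1=1,L_0=2,L_1=1$, $G_n=G_{n-1}+G_{n-2}$, extended by $F_{-n}=(-1)^{n-1}F_n$, $L_{-n}=(-1)^nL_n$). The radicand defining $B$ is negative, so $B$ is a non-real number; square roots, $\arctan$ and $\operatorname{arctanh}$ of non-real arguments denote principal branches. *)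

theory Defs
  imports "HOL-Analysis.Analysis"
begin

definition \<alpha> :: real where "\<alpha> = (1 + sqrt 5) / 2"

definition \<beta> :: real where "\<beta> = (1 - sqrt 5) / 2"

text \<open>Fibonacci and Lucas numbers with arbitrary integer index, by Binet's formulas.\<close>

definition Fibonacci :: "int \<Rightarrow> real" where
  "Fibonacci n = (\<alpha> powi n - \<beta> powi n) / sqrt 5"

definition Lucas :: "int \<Rightarrow> real" where
  "Lucas n = \<alpha> powi n + \<beta> powi n"

lemma \<alpha>_pos: "\<alpha> > 0"
  by (simp add: \<alpha>_def add_pos_pos)

lemma \<beta>_neg: "\<beta> < 0"
  by (simp add: \<beta>_def)

lemma \<beta>_eq: "\<beta> = - 1 / \<alpha>"
  using \<alpha>_pos by (simp add: \<alpha>_def \<beta>_def field_simps)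

lemma powi_golden_rec:
  fixes x :: real
  assumes "x \<noteq> 0" "x\<^sup>2 = x + 1"
  shows "x powi (n + 2) = x powi (n + 1) + x powi n"
  using assms by (simp add: power_int_add power2_eq_square algebra_simps)

lemma \<alpha>_square: "\<alpha>\<^sup>2 = \<alpha> + 1" and \<beta>_square: "\<beta>\<^sup>2 = \<beta> + 1"
  by (simp_all add: \<alpha>_def \<beta>_def power2_eq_square field_simps)

lemma Fibonacci_0: "Fibonacci 0 = 0"
  and Fibonacci_1: "Fibonacci 1 = 1"
  and Fibonacci_rec: "Fibonacci (n + 2) = Fibonacci (n + 1) + Fibonacci n"
  using \<alpha>_pos \<beta>_neg powi_golden_rec[OF _ \<alpha>_square, of n] powi_golden_rec[OF _ \<beta>_square, of n]
  by (simp_all add: Fibonacci_def diff_divide_distrib add_divide_distrib)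
     (simp add: \<alpha>_def \<beta>_def field_simps)

lemma Lucas_0: "Lucas 0 = 2"
  and Lucas_1: "Lucas 1 = 1"
  and Lucas_rec: "Lucas (n + 2) = Lucas (n + 1) + Lucas n"
  using \<alpha>_pos \<beta>_neg powi_golden_rec[OF _ \<alpha>_square, of n] powi_golden_rec[OF _ \<beta>_square, of n]
  by (simp_all add: Lucas_def) (simp add: \<alpha>_def \<beta>_def field_simps)

end

theory Submission
  imports Defs
begin

text \<open>
  The power series \<open>F(y) = \<Sum> y^k / (k^2 binom(2k,k))\<close> satisfies \<open>F(4 sin^2 a) = 2 a^2\<close> for complex \<open>a\<close> near \<open>0\<close>:
  its derivative \<open>G\<close> solves a first-order linear differential equation, which makes
  \<open>4 sin a cos a G(4 sin^2 a) - 2 a\<close> constant along the segment from \<open>0\<close> to \<open>a\<close>. The sums with weights \<open>1/k\<close> and \<open>1\<close> are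
  then algebraic in \<open>y\<close> and \<open>G(y)\<close>. Taking \<open>a = arctan w + i artanh w\<close> gives \<open>4 sin^2 a = i z\<close> with
  \<open>z = 8 w^2 / (1 - w^4)\<close>, so imaginary parts isolate the odd indices with alternating signs. Binet's formulas reduce
  the theorem to \<open>z = \<alpha>\<close> with \<open>w = A\<close> and \<open>z = -\<beta>\<close> with \<open>w = b\<close>, where \<open>B = i b\<close>; multiplication by \<open>i\<close>
  interchanges the inverse tangents: \<open>arctan (i b) = i artanh b\<close> and \<open>artanh (i b) = i arctan b\<close>.
\<close>

section \<open>Coefficients of the series, its disc of convergence, and the sine along rays\<close>

lemma central_binomial_Suc:
  "of_nat (Suc n) * of_nat ((2 * Suc n) choose Suc n) =
     (2 * of_nat (2 * n + 1) * of_nat ((2 * n) choose n) :: 'a :: {comm_ring_1, semiring_char_0})"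
proof -
  have 1: "Suc n * (Suc (Suc (2 * n)) choose Suc n) = Suc (Suc (2 * n)) * (Suc (2 * n) choose n)"
    by (rule Suc_times_binomial)
  have 2: "Suc n * (Suc (2 * n) choose Suc n) = Suc (2 * n) * ((2 * n) choose n)"
    by (rule Suc_times_binomial)
  have 3: "Suc (2 * n) choose Suc n = Suc (2 * n) choose n"
    by (subst binomial_symmetric) auto
  have "Suc n * (Suc (Suc (2 * n)) choose Suc n) = 2 * (Suc n * (Suc (2 * n) choose Suc n))"
    unfolding 1 3 by simp
  also have "\<dots> = 2 * (2 * n + 1) * ((2 * n) choose n)"
    unfolding 2 by simp
  finally have "Suc n * ((2 * Suc n) choose Suc n) = 2 * (2 * n + 1) * ((2 * n) choose n)"
    by simp
  thus ?thesis by (metis of_nat_mult of_nat_numeral)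
qed

text \<open>Division by zero makes the value at \<open>k = 0\<close> equal to 0, so the series
  effectively starts at \<open>k = 1\<close>.\<close>

definition central_binomial_coeff :: "nat \<Rightarrow> complex" where
  "central_binomial_coeff k = 1 / (of_nat k ^ 2 * of_nat ((2 * k) choose k))"

lemma summable_central_binomial_coeff:
  assumes "norm y < 4"
  shows "summable (\<lambda>k. central_binomial_coeff k * y ^ k)"
proof (rule summable_comparison_test')
  show "summable (\<lambda>k. 2 * (norm y / 4) ^ k)"
    using assms by (intro summable_mult summable_geometric) auto
  show "norm (central_binomial_coeff k * y ^ k) \<le> 2 * (norm y / 4) ^ k" if "k \<ge> 1" for k
  proof -
    \<comment> \<open>The bound 4^k / (2k) for the central binomial coefficient loses a factor k,
      which one factor of \<open>k^2\<close> absorbs. This leaves a geometric majorant of ratio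
      \<open>norm y / 4\<close>.\<close>
    have "4 ^ k / 2 \<le> real k * (4 ^ k / (2 * real k))"
      using that by simp
    also have "\<dots> \<le> real k * real ((2 * k) choose k)"
      using that by (intro mult_left_mono central_binomial_lower_bound) auto
    also have "\<dots> \<le> real k ^ 2 * real ((2 * k) choose k)"
      using that by (intro mult_right_mono) (auto simp: power2_eq_square)
    finally have "1 / (real k ^ 2 * real ((2 * k) choose k)) \<le> 1 / (4 ^ k / 2)"
      by (intro divide_left_mono) (use that in auto)
    hence "norm (central_binomial_coeff k) \<le> 2 / 4 ^ k"
      by (simp add: central_binomial_coeff_def norm_divide norm_mult norm_power)
    hence "norm (central_binomial_coeff k) * norm y ^ k \<le> 2 / 4 ^ k * norm y ^ k"
      by (rule mult_right_mono) simp
    thus ?thesis by (simp add: norm_mult norm_power power_divide)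
  qed
qed

lemma diffs_central_binomial_coeff:
  "diffs central_binomial_coeff k = 1 / (of_nat (Suc k) * of_nat ((2 * Suc k) choose Suc k))"
proof -
  have "of_nat (Suc k) \<noteq> (0 :: complex)" by (metis of_nat_eq_0_iff nat.distinct(1))
  thus ?thesis
    by (simp add: diffs_def central_binomial_coeff_def power2_eq_square del: of_nat_Suc mult_Suc_right binomial_Suc_Suc)
qed

text \<open>Both sides equal the reciprocal of the central binomial coefficient at
  \<open>Suc k\<close>. Since the factors are linear in \<open>k\<close>, this recurrence translates
  into a first-order differential equation for the generating function.\<close>

lemma diffs_central_binomial_coeff_rec:
  "(4 * of_nat k + 6) * diffs central_binomial_coeff (Suc k) = of_nat (Suc k) * diffs central_binomial_coeff k"
proof -
  have nz: "of_nat (Suc k) \<noteq> (0 :: complex)" "of_nat ((2 * Suc k) choose Suc k) \<noteq> (0 :: complex)"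
    "2 * of_nat (2 * Suc k + 1) \<noteq> (0 :: complex)"
    by (simp_all del: of_nat_Suc mult_Suc_right binomial_Suc_Suc add: binomial_eq_0_iff of_nat_eq_0_iff)
  have six: "4 * of_nat k + 6 = (2 * of_nat (2 * Suc k + 1) :: complex)" by simp
  show ?thesis
    unfolding diffs_central_binomial_coeff central_binomial_Suc[of "Suc k"] six
    using nz by (simp add: field_simps del: of_nat_Suc mult_Suc_right binomial_Suc_Suc of_nat_add of_nat_mult)
qed

text \<open>The squared norm of sin z is (cosh (2 Im z) - cos (2 Re z)) / 2. Along a ray from 0 the
  cosh term grows, and the cosine term falls as long as 2 |Re z| stays in [0, pi]. Hence 4 sin^2
  stays in the disc of convergence on the whole segment once it lies there at the endpoint.\<close>

lemma norm_sin_mult_le: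
  fixes a :: complex
  assumes "\<bar>Re a\<bar> \<le> pi / 2" "0 \<le> t" "t \<le> 1"
  shows "norm (sin (of_real t * a)) \<le> norm (sin a)"
proof -
  have sq: "norm (sin z) ^ 2 = (cosh \<bar>2 * Im z\<bar> - cos \<bar>2 * Re z\<bar>) / 2" for z :: complex
    unfolding norm_sin_squared cosh_real_abs cos_abs_real by (simp add: cosh_field_def exp_minus field_simps)
  have le: "t * \<bar>x\<bar> \<le> \<bar>x\<bar>" for x :: real
    using mult_right_mono[OF \<open>t \<le> 1\<close>, of "\<bar>x\<bar>"] by simp
  have "cosh \<bar>2 * Im (of_real t * a)\<bar> \<le> cosh \<bar>2 * Im a\<bar>"
    using le[of "Im a"] assms by (subst cosh_real_nonneg_le_iff) (auto simp: abs_mult)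
  moreover have "cos \<bar>2 * Re a\<bar> \<le> cos \<bar>2 * Re (of_real t * a)\<bar>"
    using le[of "Re a"] assms by (intro cos_monotone_0_pi_le) (auto simp: abs_mult)
  ultimately have "norm (sin (of_real t * a)) ^ 2 \<le> norm (sin a) ^ 2"
    unfolding sq by simp
  thus ?thesis by (rule power2_le_imp_le) simp
qed

section \<open>The differential equation of the series and its solution\<close>

context
  fixes F G G' :: "complex \<Rightarrow> complex"
  defines "F \<equiv> \<lambda>y. \<Sum>k. central_binomial_coeff k * y ^ k"
    and "G \<equiv> \<lambda>y. \<Sum>k. diffs central_binomial_coeff k * y ^ k"
    and "G' \<equiv> \<lambda>y. \<Sum>k. diffs (diffs central_binomial_coeff) k * y ^ k"
begin

lemma central_binomial_deriv:
  assumes "norm y < 4"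
  shows "(F has_field_derivative G y) (at y)" and "(G has_field_derivative G' y) (at y)"
    and "(\<lambda>k. central_binomial_coeff k * y ^ k) sums F y"
    and "(\<lambda>k. diffs central_binomial_coeff k * y ^ k) sums G y"
    and "(\<lambda>k. diffs (diffs central_binomial_coeff) k * y ^ k) sums G' y"
proof -
  note s0 = summable_central_binomial_coeff
  have s1: "summable (\<lambda>k. diffs central_binomial_coeff k * z ^ k)" if "norm z < 4" for z
    using termdiff_converges[OF that s0] .
  have s2: "summable (\<lambda>k. diffs (diffs central_binomial_coeff) k * z ^ k)" if "norm z < 4" for z
    using termdiff_converges[OF that s1] .
  show "(F has_field_derivative G y) (at y)" "(G has_field_derivative G' y) (at y)"
    unfolding F_def G_def G'_def
    by (intro termdiffs_strong'[OF _ assms] s0 s1; assumption)+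
  show "(\<lambda>k. central_binomial_coeff k * y ^ k) sums F y"
    and "(\<lambda>k. diffs central_binomial_coeff k * y ^ k) sums G y"
    and "(\<lambda>k. diffs (diffs central_binomial_coeff) k * y ^ k) sums G' y"
    unfolding F_def G_def G'_def using s0[OF assms] s1[OF assms] s2[OF assms]
    by (simp_all add: summable_sums)
qed

lemma diffs_central_binomial_sums:
  assumes "norm y < 4"
  shows "(\<lambda>k. of_nat k * diffs central_binomial_coeff k * y ^ k) sums (y * G' y)"
proof -
  have "(\<lambda>k. y * (diffs (diffs central_binomial_coeff) k * y ^ k)) sums (y * G' y)"
    by (intro sums_mult central_binomial_deriv assms)
  hence "(\<lambda>k. of_nat (Suc k) * diffs central_binomial_coeff (Suc k) * y ^ Suc k) sums (y * G' y)"
    by (simp add: diffs_def mult_ac)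
  thus ?thesis by (subst (asm) sums_Suc_iff) simp
qed

text \<open>The operator y d/dy multiplies the k-th coefficient by k. The recurrence therefore
  identifies 4 y G' + 2 G with y (y G' + G), up to the term at \<open>k = 0\<close>.\<close>

lemma central_binomial_ode:
  assumes "norm y < 4"
  shows "y * (4 - y) * G' y = 1 + (y - 2) * G y"
proof -
  let ?p = "diffs central_binomial_coeff"
  note sG = central_binomial_deriv(4)[OF assms] and sG' = diffs_central_binomial_sums[OF assms]
  have "(\<lambda>k. 4 * (of_nat k * ?p k * y ^ k) + 2 * (?p k * y ^ k)) sums (4 * (y * G' y) + 2 * G y)"
    by (intro sums_add sums_mult sG sG')
  hence 1: "(\<lambda>k. (4 * of_nat k + 2) * ?p k * y ^ k) sums (4 * (y * G' y) + 2 * G y)"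
    by (simp add: algebra_simps)
  have "(\<lambda>k. y * (of_nat k * ?p k * y ^ k + ?p k * y ^ k)) sums (y * (y * G' y + G y))"
    by (intro sums_add sums_mult sG sG')
  also have "(\<lambda>k. y * (of_nat k * ?p k * y ^ k + ?p k * y ^ k)) =
      (\<lambda>k. (4 * of_nat (Suc k) + 2) * ?p (Suc k) * y ^ Suc k)"
  proof
    fix k
    have "y * (of_nat k * ?p k * y ^ k + ?p k * y ^ k) = (of_nat (Suc k) * ?p k) * y ^ Suc k"
      by (simp add: algebra_simps)
    also have "of_nat (Suc k) * ?p k = (4 * of_nat k + 6) * ?p (Suc k)"
      by (rule diffs_central_binomial_coeff_rec [symmetric])
    finally show "y * (of_nat k * ?p k * y ^ k + ?p k * y ^ k) =
      (4 * of_nat (Suc k) + 2) * ?p (Suc k) * y ^ Suc k" by (simp only: of_nat_Suc) (simp add: algebra_simps)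
  qed
  \<comment> \<open>Undoing the index shift adds the term at \<open>k = 0\<close>, which is 2 *
    (1/2) = 1: the inhomogeneity of the equation.\<close>
  finally have "(\<lambda>k. (4 * of_nat k + 2) * ?p k * y ^ k) sums
      (y * (y * G' y + G y) + (4 * of_nat 0 + 2) * ?p 0 * y ^ 0)"
    by (subst (asm) sums_Suc_iff) simp
  with 1 have "4 * (y * G' y) + 2 * G y = y * (y * G' y + G y) + (4 * of_nat 0 + 2) * ?p 0 * y ^ 0"
    by (rule sums_unique2)
  also have "?p 0 = 1 / 2" by (simp add: diffs_central_binomial_coeff)
  finally show ?thesis by (simp add: algebra_simps)
qed

lemma central_binomial_closed_form:
  fixes a :: complex
  assumes a: "\<bar>Re a\<bar> \<le> pi / 2" "norm (sin a) < 1"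
  shows "4 * sin a * cos a * G (4 * sin a ^ 2) = 2 * a" (is ?th1) and "F (4 * sin a ^ 2) = 2 * a ^ 2" (is ?th2)
proof -
  let ?y = "\<lambda>z :: complex. 4 * sin z ^ 2"
  have less: "norm (?y z) < 4" if z: "z \<in> closed_segment 0 a" for z
  proof -
    obtain t where t: "0 \<le> t" "t \<le> 1" "z = of_real t * a"
      using z by (auto simp: in_segment scaleR_conv_of_real)
    have "norm (sin z) < 1"
      using norm_sin_mult_le[OF a(1) t(1,2)] a(2) t(3) by simp
    thus ?thesis by (simp add: norm_mult norm_power power_less_one_iff)
  qed
  have dy: "(?y has_field_derivative 8 * sin z * cos z) (at z within S)" for z S
    by (auto intro!: derivative_eq_intros)
  have dF: "((\<lambda>z. F (?y z)) has_field_derivative G (?y z) * (8 * sin z * cos z)) (at z within S)"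
    and dG: "((\<lambda>z. G (?y z)) has_field_derivative G' (?y z) * (8 * sin z * cos z)) (at z within S)"
    if "z \<in> closed_segment 0 a" for z S
    by (rule DERIV_chain2[OF _ dy] central_binomial_deriv less that)+
  have ends: "0 \<in> closed_segment 0 a" "a \<in> closed_segment 0 a" by auto
  have main: "4 * sin z * cos z * G (?y z) - 2 * z = 0" if "z \<in> closed_segment 0 a" for z
  proof -
    have "\<exists>c. \<forall>z\<in>closed_segment 0 a. 4 * sin z * cos z * G (?y z) - 2 * z = c"
    proof (rule has_field_derivative_zero_constant)
      fix z assume z: "z \<in> closed_segment 0 a"
      have "((\<lambda>z. 4 * sin z * cos z * G (?y z) - 2 * z) has_field_derivative
          (4 * sin z * cos z * (G' (?y z) * (8 * sin z * cos z)) +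
           (4 * cos z * cos z - 4 * sin z * sin z) * G (?y z) - 2)) (at z within closed_segment 0 a)"
        by (rule derivative_eq_intros dG z refl | simp)+
      also have "4 * sin z * cos z * (G' (?y z) * (8 * sin z * cos z)) +
           (4 * cos z * cos z - 4 * sin z * sin z) * G (?y z) - 2 =
           2 * (16 * (sin z)\<^sup>2 * (cos z)\<^sup>2 * G' (?y z)) + (4 * (cos z)\<^sup>2 - 4 * (sin z)\<^sup>2) * G (?y z) - 2"
        by (simp add: power2_eq_square)
      \<comment> \<open>Since 4 - y = 4 cos^2 z, the coefficient of \<open>G'\<close> is exactly y
        (4 - y), so the differential equation eliminates \<open>G'\<close> and the remaining terms
        cancel.\<close>
      also have "16 * (sin z)\<^sup>2 * (cos z)\<^sup>2 * G' (?y z) = ?y z * (4 - ?y z) * G' (?y z)"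
        by (simp add: cos_squared_eq algebra_simps)
      also have "\<dots> = 1 + (?y z - 2) * G (?y z)"
        by (rule central_binomial_ode[OF less[OF z]])
      also have "2 * (1 + (?y z - 2) * G (?y z)) + (4 * (cos z)\<^sup>2 - 4 * (sin z)\<^sup>2) * G (?y z) - 2 = 0"
        by (simp add: cos_squared_eq algebra_simps)
      finally show "((\<lambda>z. 4 * sin z * cos z * G (?y z) - 2 * z) has_field_derivative 0)
          (at z within closed_segment 0 a)" .
    qed simp
    then obtain c where c: "\<And>z. z \<in> closed_segment 0 a \<Longrightarrow> 4 * sin z * cos z * G (?y z) - 2 * z = c" by blast
    from c[OF ends(1)] have "c = 0" by simp
    with c[OF that] show ?thesis by simp
  qed
  from main[OF ends(2)] show ?th1 by simp
  \<comment> \<open>A second integration: by \<open>main\<close>, the derivative of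
    \<open>F (?y z)\<close> is 4 z.\<close>
  have "\<exists>c. \<forall>z\<in>closed_segment 0 a. F (?y z) - 2 * z ^ 2 = c"
  proof (rule has_field_derivative_zero_constant)
    fix z assume z: "z \<in> closed_segment 0 a"
    have "G (?y z) * (8 * sin z * cos z) - 4 * z = 0"
      using main[OF z] by (simp add: algebra_simps)
    moreover have "((\<lambda>z. F (?y z) - 2 * z ^ 2) has_field_derivative
        (G (?y z) * (8 * sin z * cos z) - 4 * z)) (at z within closed_segment 0 a)"
      by (rule derivative_eq_intros dF z refl | simp)+
    ultimately show "((\<lambda>z. F (?y z) - 2 * z ^ 2) has_field_derivative 0) (at z within closed_segment 0 a)"
      by (simp only:)
  qed simp
  then obtain c where c: "\<And>z. z \<in> closed_segment 0 a \<Longrightarrow> F (?y z) - 2 * z ^ 2 = c" by blast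
  have "F 0 = 0"
    unfolding F_def by (subst powser_zero) (simp add: central_binomial_coeff_def)
  with c[OF ends(1)] have "c = 0" by simp
  with c[OF ends(2)] show ?th2 by simp
qed

text \<open>The weight 1/k gives y G, known from the closed form. The weight 1 gives y (y G)' = y (G
  + y G') plus the term at \<open>k = 0\<close>; the differential equation expresses it through y G,
  so no further integration is required.\<close>

lemma central_binomial_sums:
  fixes a :: complex
  assumes a: "\<bar>Re a\<bar> \<le> pi / 2" "norm (sin a) < 1"
  defines "y \<equiv> 4 * sin a ^ 2"
  shows "(\<lambda>k. y ^ k / (of_nat k ^ 2 * of_nat ((2 * k) choose k))) sums (2 * a ^ 2)"
    and "(\<lambda>k. y ^ k / (of_nat k * of_nat ((2 * k) choose k))) sums (2 * a * tan a)"
    and "(\<lambda>k. y ^ k / of_nat ((2 * k) choose k)) sums ((1 + a * tan a) / cos a ^ 2)"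
proof -
  have y: "norm y < 4"
    using a(2) by (simp add: y_def norm_mult norm_power power_less_one_iff)
  have c: "cos a \<noteq> 0"
  proof
    assume "cos a = 0"
    hence "sin a ^ 2 = 1" by (simp add: sin_squared_eq)
    hence "norm (sin a) ^ 2 = 1" by (metis norm_one norm_power)
    moreover have "norm (sin a) ^ 2 < 1" using a(2) by (simp add: power_less_one_iff)
    ultimately show False by simp
  qed
  note cf = central_binomial_closed_form[OF a, folded y_def]
  have yG: "y * G y = 2 * a * tan a"
  proof -
    have "y * G y = (4 * sin a * cos a * G y) * sin a / cos a"
      using c by (simp add: y_def power2_eq_square)
    thus ?thesis unfolding cf by (simp add: tan_def)
  qed
  have ode: "(4 - y) * (y * (G y + y * G' y)) = 2 * (y * G y) + y"
  proof -
    have "(4 - y) * (y * (G y + y * G' y)) = y * ((4 - y) * G y + (y * (4 - y) * G' y))" by algebra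
    thus ?thesis unfolding central_binomial_ode[OF y] by (simp add: algebra_simps)
  qed
  have y4: "4 - y = 4 * cos a ^ 2" by (simp add: y_def cos_squared_eq)
  have "4 - y \<noteq> 0" using c y4 by simp
  hence "1 + y * (G y + y * G' y) = 1 + (2 * (y * G y) + y) / (4 - y)"
    unfolding ode [symmetric] by simp
  also have "\<dots> = (1 + a * tan a) / cos a ^ 2"
    using c unfolding yG y4 by (simp add: divide_simps) (simp add: y_def sin_squared_eq algebra_simps)
  finally have f0: "1 + y * (G y + y * G' y) = (1 + a * tan a) / cos a ^ 2" .
  show "(\<lambda>k. y ^ k / (of_nat k ^ 2 * of_nat ((2 * k) choose k))) sums (2 * a ^ 2)"
    using central_binomial_deriv(3)[OF y] by (simp add: cf central_binomial_coeff_def)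
  have "(\<lambda>k. y * (diffs central_binomial_coeff k * y ^ k)) sums (2 * a * tan a)"
    unfolding yG [symmetric] by (intro sums_mult central_binomial_deriv y)
  hence "(\<lambda>k. y ^ Suc k / (of_nat (Suc k) * of_nat ((2 * Suc k) choose Suc k))) sums (2 * a * tan a)"
    unfolding diffs_central_binomial_coeff by simp
  thus "(\<lambda>k. y ^ k / (of_nat k * of_nat ((2 * k) choose k))) sums (2 * a * tan a)"
    \<comment> \<open>The restored term at \<open>k = 0\<close> is a division by zero, hence 0; in
      the third series it is 1.\<close>
    by (subst (asm) sums_Suc_iff) simp
  have "(\<lambda>k. y * (diffs central_binomial_coeff k * y ^ k + of_nat k * diffs central_binomial_coeff k * y ^ k)) sums
      (y * (G y + y * G' y))"
    by (intro sums_mult sums_add diffs_central_binomial_sums central_binomial_deriv y)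
  moreover have "y * (diffs central_binomial_coeff k * y ^ k + of_nat k * diffs central_binomial_coeff k * y ^ k) =
      y ^ Suc k / of_nat ((2 * Suc k) choose Suc k)" for k
  proof -
    have "of_nat (Suc k) \<noteq> (0 :: complex)" by (metis of_nat_eq_0_iff nat.distinct(1))
    moreover have "y * (diffs central_binomial_coeff k * y ^ k + of_nat k * diffs central_binomial_coeff k * y ^ k) =
       of_nat (Suc k) * diffs central_binomial_coeff k * y ^ Suc k"
      by (simp add: algebra_simps)
    ultimately show ?thesis
      unfolding diffs_central_binomial_coeff by (simp del: of_nat_Suc mult_Suc_right binomial_Suc_Suc)
  qed
  ultimately have "(\<lambda>k. y ^ Suc k / of_nat ((2 * Suc k) choose Suc k)) sums (y * (G y + y * G' y))"
    by (simp only:)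
  hence "(\<lambda>k. y ^ k / of_nat ((2 * k) choose k)) sums (1 + y * (G y + y * G' y))"
    by (subst (asm) sums_Suc_iff) (simp add: add.commute)
  thus "(\<lambda>k. y ^ k / of_nat ((2 * k) choose k)) sums ((1 + a * tan a) / cos a ^ 2)"
    unfolding f0 .
qed

end

section \<open>The point a = arctan w + i artanh w and the odd-indexed real series\<close>

lemma tanh_artanh_real:
  fixes w :: real
  assumes "\<bar>w\<bar> < 1"
  shows "tanh (artanh w) = w"
proof -
  have pos: "(1 + w) / (1 - w) > 0" using assms by auto
  hence "artanh w = ln (sqrt ((1 + w) / (1 - w)))"
    by (simp add: artanh_def ln_sqrt)
  hence "tanh (artanh w) = ((1 + w) / (1 - w) - 1) / ((1 + w) / (1 - w) + 1)"
    using pos by (simp add: tanh_ln_real)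
  also have "\<dots> = w"
    using assms by (simp add: divide_simps)
  finally show ?thesis .
qed

text \<open>The two summands of \<open>a\<close> have tangents w and i w, and the addition theorem
  combines them. The factor 1 - i w^2 of cos a has real part 1 and so cannot vanish.\<close>

lemma tan_arctan_plus_i_artanh:
  fixes w :: real
  assumes w: "\<bar>w\<bar> < 1"
  defines "a \<equiv> Complex (arctan w) (artanh w)"
  shows "cos a \<noteq> 0" "tan a = of_real w * (1 + \<i>) / (1 - \<i> * of_real (w ^ 2))"
proof -
  define u v :: complex where "u = of_real (arctan w)" and "v = \<i> * of_real (artanh w)"
  have a: "a = u + v" by (simp add: a_def u_def v_def Complex_eq)
  have cu: "cos u \<noteq> 0" by (simp add: u_def cos_of_real)
  have tu: "tan u = of_real w" by (simp add: u_def tan_arctan flip: tan_of_real)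
  have cosh: "cosh (of_real (artanh w) :: complex) = of_real (cosh (artanh w))"
    by (simp add: cosh_field_def flip: exp_of_real)
  have sinh: "sinh (of_real (artanh w) :: complex) = of_real (sinh (artanh w))"
    by (simp add: sinh_field_def flip: exp_of_real)
  have "cos v = of_real (cosh (artanh w))"
    unfolding v_def cosh_conv_cos [symmetric] by (rule cosh)
  moreover have "cosh (artanh w) > 0" by simp
  ultimately have cv: "cos v \<noteq> 0" by (metis of_real_eq_0_iff less_irrefl)
  have "tanh (of_real (artanh w) :: complex) = of_real (tanh (artanh w))"
    unfolding tanh_def cosh sinh by simp
  hence "-\<i> * tan v = of_real w"
    unfolding v_def tanh_conv_tan using tanh_artanh_real[OF w] by simp
  hence tv: "tan v = \<i> * of_real w"
    by (metis complex_i_mult_minus mult.assoc mult.commute mult_minus_right minus_minus)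
  have nz: "1 - \<i> * of_real (w ^ 2) \<noteq> 0"
    by (simp add: complex_eq_iff)
  have "cos a = cos u * cos v * (1 - tan u * tan v)"
    unfolding a cos_add using cu cv by (simp add: tan_def algebra_simps)
  also have "1 - tan u * tan v = 1 - \<i> * of_real (w ^ 2)"
    unfolding tu tv by (simp add: power2_eq_square)
  finally show ca: "cos a \<noteq> 0" using cu cv nz by auto
  show "tan a = of_real w * (1 + \<i>) / (1 - \<i> * of_real (w ^ 2))"
    unfolding a using tan_add[of u v] cu cv ca by (simp add: a tu tv power2_eq_square algebra_simps)
qed

text \<open>For real z, the power (i z)^k is real when k is even and i (-1)^n z^k when k = 2n + 1.
  Taking imaginary parts thus drops the even indices and produces the alternating sign.\<close>

lemma sums_odd_part:
  fixes z :: real and c :: "nat \<Rightarrow> real"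
  assumes "(\<lambda>k. (\<i> * of_real z) ^ k / of_real (c k)) sums S"
  shows "(\<lambda>n. (-1) ^ n * z ^ (2 * n + 1) / c (2 * n + 1)) sums Im S"
proof -
  let ?f = "\<lambda>k. Im ((\<i> * of_real z) ^ k / of_real (c k))"
  have "(\<lambda>n. ?f (2 * n + 1)) sums Im S \<longleftrightarrow> ?f sums Im S"
  proof (rule sums_mono_reindex)
    fix k :: nat assume k: "k \<notin> range (\<lambda>n. 2 * n + 1)"
    have "even k"
    proof (rule ccontr)
      assume "odd k"
      then obtain n where "k = 2 * n + 1" by (elim oddE)
      with k show False by blast
    qed
    then obtain n where "k = 2 * n" by (elim evenE)
    moreover have "(\<i> * of_real z) ^ 2 = of_real (- (z ^ 2))"
      by (simp add: power_mult_distrib)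
    ultimately have "(\<i> * of_real z) ^ k = of_real ((- (z ^ 2)) ^ n)"
      by (simp only: power_mult of_real_power)
    thus "?f k = 0" by (simp only: of_real_divide [symmetric] Im_complex_of_real)
  qed (auto simp: strict_mono_def)
  moreover have "?f sums Im S" by (rule sums_Im[OF assms])
  moreover have "?f (2 * n + 1) = (-1) ^ n * z ^ (2 * n + 1) / c (2 * n + 1)" for n
  proof -
    have "(\<i> * of_real z) ^ (2 * n + 1) = \<i> * of_real ((- (z ^ 2)) ^ n * z)"
      by (simp add: power_mult power_mult_distrib power_add)
    also have "(- (z ^ 2)) ^ n * z = (-1) ^ n * z ^ (2 * n + 1)"
      by (simp add: power_minus [of "z ^ 2"] power_mult)
    finally have "(\<i> * of_real z) ^ (2 * n + 1) = \<i> * of_real ((-1) ^ n * z ^ (2 * n + 1))" .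
    hence "(\<i> * of_real z) ^ (2 * n + 1) / of_real (c (2 * n + 1)) =
       \<i> * of_real ((-1) ^ n * z ^ (2 * n + 1) / c (2 * n + 1))"
      by (simp only: of_real_divide times_divide_eq_right)
    thus ?thesis by (simp only: Im_i_times Re_complex_of_real)
  qed
  ultimately show ?thesis by (simp only:)
qed

lemma alternating_odd_central_binomial_sums:
  fixes w z :: real
  assumes w: "0 < w" "w < 1" and z: "z = 8 * w ^ 2 / (1 - w ^ 4)" "z < 4"
  shows "(\<lambda>n. (-1) ^ n * z ^ (2 * n + 1) / ((2 * real n + 1) ^ 2 * real ((4 * n + 2) choose (2 * n + 1))))
           sums (4 * arctan w * artanh w)"
    and "(\<lambda>n. (-1) ^ n * z ^ (2 * n + 1) / ((2 * real n + 1) * real ((4 * n + 2) choose (2 * n + 1))))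
           sums (2 * w * ((1 - w ^ 2) * artanh w + (1 + w ^ 2) * arctan w) / (1 + w ^ 4))"
    and "(\<lambda>n. (-1) ^ n * z ^ (2 * n + 1) / real ((4 * n + 2) choose (2 * n + 1)))
           sums (2 * w ^ 2 * (1 - w ^ 4) / (1 + w ^ 4) ^ 2
             + w * ((1 + w ^ 2) * (1 - w ^ 2) ^ 2 * (w ^ 4 + 4 * w ^ 2 + 1) / (1 + w ^ 4) ^ 3) * arctan w
             + w * ((1 - w ^ 2) * (1 + w ^ 2) ^ 2 * (w ^ 4 - 4 * w ^ 2 + 1) / (1 + w ^ 4) ^ 3) * artanh w)"
proof -
  define a where "a = Complex (arctan w) (artanh w)"
  define u where "u = 1 - \<i> * of_real (w ^ 2)"
  define d where "d = 1 + w ^ 4"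
  define q :: complex where "q = of_real w * (1 + \<i>)"
  have w4: "w ^ 4 < 1" using w by (simp add: power_less_one_iff)
  hence nz: "1 - w ^ 4 \<noteq> 0" by simp
  have d: "d > 0" unfolding d_def using w by (simp add: add_pos_pos)
  have u: "u \<noteq> 0" by (simp add: u_def complex_eq_iff)
  have ca: "cos a \<noteq> 0" and ta: "tan a = q / u"
    using tan_arctan_plus_i_artanh[of w] w by (auto simp: a_def u_def q_def)
  have inv_cos: "1 / cos a ^ 2 = 1 + tan a ^ 2"
    using ca by (simp add: tan_def field_simps)
  have "1 + tan a ^ 2 = (u ^ 2 + q ^ 2) / u ^ 2"
    unfolding ta using u by (simp add: field_simps)
  \<comment> \<open>Here q^2 = 2 i w^2 cancels the imaginary part of u^2 = 1 - w^4 - 2 i w^2. This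
    makes 4 sin^2 a purely imaginary.\<close>
  also have "u ^ 2 + q ^ 2 = of_real (1 - w ^ 4)"
    by (simp add: u_def q_def complex_eq_iff power2_eq_square power4_eq_xxxx algebra_simps)
  finally have sec2: "1 + tan a ^ 2 = of_real (1 - w ^ 4) / u ^ 2" .
  have "4 * sin a ^ 2 = 4 * tan a ^ 2 / (1 / cos a ^ 2)"
    using ca by (simp add: tan_def power_divide)
  also have "\<dots> = 4 * q ^ 2 / of_real (1 - w ^ 4)"
    unfolding inv_cos sec2 unfolding ta using u nz by (simp add: power_divide)
  also have "\<dots> = \<i> * of_real z"
    by (simp add: z(1) q_def complex_eq_iff Re_divide_of_real Im_divide_of_real power2_eq_square)
  finally have y: "4 * sin a ^ 2 = \<i> * of_real z" .
  have z0: "z \<ge> 0" unfolding z(1) using w4 by simp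
  \<comment> \<open>The hypothesis \<open>z < 4\<close> is precisely the condition for
    convergence.\<close>
  have "norm (4 * sin a ^ 2) < 4" unfolding y using z0 z(2) by (simp add: norm_mult)
  hence "norm (sin a) ^ 2 < 1" by (simp add: norm_mult norm_power)
  hence small: "norm (sin a) < 1" by (simp add: power_less_one_iff)
  have "\<bar>Re a\<bar> \<le> pi / 2"
    using arctan_bounded[of w] by (simp add: a_def abs_if)
  note S = central_binomial_sums[OF this small, unfolded y]
  \<comment> \<open>Rationalization: u times its conjugate is \<open>d\<close>, and (1 + i)(1 + i
    w^2) = (1 - w^2) + i (1 + w^2). Likewise \<open>inv_u\<close> comes from (1 + i w^2)^2 = 1 - w^4
    + 2 i w^2.\<close>
  have tan_form: "tan a = of_real (w / d) * Complex (1 - w ^ 2) (1 + w ^ 2)"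
  proof -
    have "q * of_real d = of_real w * Complex (1 - w ^ 2) (1 + w ^ 2) * u"
      by (simp add: q_def u_def d_def complex_eq_iff power2_eq_square power4_eq_xxxx algebra_simps)
    thus ?thesis unfolding ta using u d by (simp add: field_simps)
  qed
  have inv_u: "1 / u ^ 2 = Complex ((1 - w ^ 4) / d ^ 2) (2 * w ^ 2 / d ^ 2)"
  proof -
    have "of_real (d ^ 2) = Complex (1 - w ^ 4) (2 * w ^ 2) * u ^ 2"
      by (simp add: u_def d_def complex_eq_iff power2_eq_square power4_eq_xxxx algebra_simps)
    moreover have "Complex ((1 - w ^ 4) / d ^ 2) (2 * w ^ 2 / d ^ 2) = Complex (1 - w ^ 4) (2 * w ^ 2) / of_real (d ^ 2)"
      by (simp add: complex_eq_iff Re_divide_of_real Im_divide_of_real)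
    moreover have "Complex (1 - w ^ 4) (2 * w ^ 2) \<noteq> 0"
      using nz by (simp add: complex_eq_iff)
    ultimately show ?thesis using u d by (simp add: frac_eq_eq)
  qed
  have "(\<lambda>n. (-1) ^ n * z ^ (2 * n + 1) / (real (2 * n + 1) ^ 2 * real ((2 * (2 * n + 1)) choose (2 * n + 1))))
          sums Im (2 * a ^ 2)"
    by (rule sums_odd_part) (use S(1) in simp)
  also have "Im (2 * a ^ 2) = 4 * arctan w * artanh w"
    by (simp add: a_def power2_eq_square)
  finally show "(\<lambda>n. (-1) ^ n * z ^ (2 * n + 1) / ((2 * real n + 1) ^ 2 * real ((4 * n + 2) choose (2 * n + 1))))
           sums (4 * arctan w * artanh w)"
    by (simp add: add_ac)
  have "(\<lambda>n. (-1) ^ n * z ^ (2 * n + 1) / (real (2 * n + 1) * real ((2 * (2 * n + 1)) choose (2 * n + 1))))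
          sums Im (2 * a * tan a)"
    by (rule sums_odd_part) (use S(2) in simp)
  also have "Im (2 * a * tan a) = 2 * w * ((1 - w ^ 2) * artanh w + (1 + w ^ 2) * arctan w) / (1 + w ^ 4)"
    unfolding tan_form d_def [symmetric] using d by (simp add: a_def field_simps)
  finally show "(\<lambda>n. (-1) ^ n * z ^ (2 * n + 1) / ((2 * real n + 1) * real ((4 * n + 2) choose (2 * n + 1))))
           sums (2 * w * ((1 - w ^ 2) * artanh w + (1 + w ^ 2) * arctan w) / (1 + w ^ 4))"
    by (simp add: add_ac)
  have "(\<lambda>n. (-1) ^ n * z ^ (2 * n + 1) / real ((2 * (2 * n + 1)) choose (2 * n + 1)))
          sums Im ((1 + a * tan a) / cos a ^ 2)"
    by (rule sums_odd_part) (use S(3) in simp)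
  also have "(1 + a * tan a) / cos a ^ 2 = (1 + a * tan a) * (1 / cos a ^ 2)" by simp
  also have "1 / cos a ^ 2 = of_real (1 - w ^ 4) * (1 / u ^ 2)"
    unfolding inv_cos sec2 by simp
  also have "Im ((1 + a * tan a) * (of_real (1 - w ^ 4) * (1 / u ^ 2))) =
      (1 - w ^ 4) / d ^ 2 * (2 * w ^ 2 + w / d * (
        (1 - w ^ 4) * (arctan w * (1 + w ^ 2) + artanh w * (1 - w ^ 2)) +
        2 * w ^ 2 * (arctan w * (1 - w ^ 2) - artanh w * (1 + w ^ 2))))"
    unfolding tan_form inv_u using d by (simp add: a_def divide_simps) (simp add: algebra_simps power_numeral_reduce)
  \<comment> \<open>The quartic factors arise by collecting: arctan w gets (1 - w^2)((1 + w^2)^2 + 2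
    w^2), and artanh w gets (1 + w^2)((1 - w^2)^2 - 2 w^2).\<close>
  also have "\<dots> = 2 * w ^ 2 * (1 - w ^ 4) / d ^ 2
             + w * ((1 + w ^ 2) * (1 - w ^ 2) ^ 2 * (w ^ 4 + 4 * w ^ 2 + 1) / d ^ 3) * arctan w
             + w * ((1 - w ^ 2) * (1 + w ^ 2) ^ 2 * (w ^ 4 - 4 * w ^ 2 + 1) / d ^ 3) * artanh w"
    using d by (simp add: divide_simps) (simp add: algebra_simps power_numeral_reduce)
  finally show "(\<lambda>n. (-1) ^ n * z ^ (2 * n + 1) / real ((4 * n + 2) choose (2 * n + 1)))
           sums (2 * w ^ 2 * (1 - w ^ 4) / (1 + w ^ 4) ^ 2
             + w * ((1 + w ^ 2) * (1 - w ^ 2) ^ 2 * (w ^ 4 + 4 * w ^ 2 + 1) / (1 + w ^ 4) ^ 3) * arctan w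
             + w * ((1 - w ^ 2) * (1 + w ^ 2) ^ 2 * (w ^ 4 - 4 * w ^ 2 + 1) / (1 + w ^ 4) ^ 3) * artanh w)"
    unfolding d_def by (simp add: add_ac)
qed

section \<open>Solving for w, imaginary arguments, and Binet's formulas\<close>

lemma quadratic_parameter:
  fixes z w :: real
  assumes z: "z > 0" and w: "w = sqrt ((sqrt (64 + 4 * z ^ 2) - 8) / (2 * z))"
  shows "0 < w" "w < 1" "z = 8 * w ^ 2 / (1 - w ^ 4)"
proof -
  define r where "r = sqrt (64 + 4 * z ^ 2)"
  have r2: "r ^ 2 = 64 + 4 * z ^ 2" by (simp add: r_def add_nonneg_nonneg)
  have "sqrt (8 ^ 2) < r" unfolding r_def using z by (intro real_sqrt_less_mono) simp
  hence r8: "8 < r" by simp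
  have "r < sqrt ((8 + 2 * z) ^ 2)"
    unfolding r_def using z by (intro real_sqrt_less_mono) (simp add: power2_eq_square algebra_simps)
  hence ru: "r < 8 + 2 * z" using z by simp
  have w: "w = sqrt ((r - 8) / (2 * z))" by (simp add: w r_def)
  have w2: "w ^ 2 = (r - 8) / (2 * z)" using r8 z by (simp add: w)
  show w0: "0 < w" using r8 z by (simp add: w)
  have "w ^ 2 < 1" unfolding w2 using ru z by (simp add: field_simps)
  thus w1: "w < 1" using w0 by (simp add: power_less_one_iff)
  hence "w ^ 4 < 1" using w0 by (simp add: power_less_one_iff)
  \<comment> \<open>The relation between z and w is a quadratic equation in w^2, and the given
    radicand is its positive root.\<close>
  moreover have "z * (w ^ 2) ^ 2 + 8 * w ^ 2 = z"
    unfolding w2 using z r2 by (simp add: field_simps power2_eq_square)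
  hence "z * (1 - w ^ 4) = 8 * w ^ 2" by (simp add: algebra_simps)
  ultimately show "z = 8 * w ^ 2 / (1 - w ^ 4)" by (simp add: field_simps)
qed

text \<open>For |b| < 1 the argument of the principal logarithm is the positive real (1 + b) / (1 -
  b), so the complex logarithm is the real one.\<close>

lemma Arctan_i_times:
  assumes "\<bar>b\<bar> < 1"
  shows "Arctan (\<i> * of_real b) = \<i> * of_real (artanh b)"
proof -
  have "(1 - \<i> * (\<i> * of_real b)) / (1 + \<i> * (\<i> * of_real b)) = of_real ((1 + b) / (1 - b))"
    by (simp add: mult.assoc [symmetric])
  moreover have "(1 + b) / (1 - b) > 0" using assms by auto
  ultimately have "Ln ((1 - \<i> * (\<i> * of_real b)) / (1 + \<i> * (\<i> * of_real b))) = of_real (ln ((1 + b) / (1 - b)))"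
    by (simp only: Ln_of_real)
  thus ?thesis unfolding Arctan_def artanh_def by simp
qed

text \<open>The logarithm defining artanh at i b is the one defining Arctan at -b, which is real for
  every real b.\<close>

lemma artanh_i_times: "artanh (\<i> * of_real b) = \<i> * of_real (arctan b)"
proof -
  have "Arctan (of_real (- b)) = of_real (arctan (- b))"
    by (rule Arctan_of_real)
  hence "\<i> * (Ln ((1 + \<i> * of_real b) / (1 - \<i> * of_real b)) / 2) = - of_real (arctan b)"
    by (simp add: Arctan_def arctan_minus)
  hence "\<i> * (\<i> * artanh (\<i> * of_real b)) = - (\<i> * of_real (arctan b))"
    by (simp add: artanh_def)
  thus ?thesis by (simp add: mult.assoc [symmetric])
qed

text \<open>Split 2n + s as (s - 1) + (2n + 1). The second series uses \<open>- \<beta>\<close>,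
  which is positive as \<open>quadratic_parameter\<close> demands; the odd power then flips the sign
  of the \<beta> part in both Binet formulas.\<close>

lemma Lucas_Fibonacci_sums:
  fixes d :: "nat \<Rightarrow> real"
  assumes "(\<lambda>n. (-1) ^ n * \<alpha> ^ (2 * n + 1) / d n) sums P" "(\<lambda>n. (-1) ^ n * (- \<beta>) ^ (2 * n + 1) / d n) sums Q"
  shows "(\<lambda>n. (-1) ^ n * Lucas (2 * int n + s) / d n) sums (\<alpha> powi (s - 1) * P - \<beta> powi (s - 1) * Q)"
    and "(\<lambda>n. (-1) ^ n * Fibonacci (2 * int n + s) / d n) sums ((\<alpha> powi (s - 1) * P + \<beta> powi (s - 1) * Q) / sqrt 5)"
proof -
  have powi: "x powi (2 * int n + s) = x powi (s - 1) * x ^ (2 * n + 1)" if "x \<noteq> 0" for x :: real and n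
  proof -
    have "2 * int n + s = (s - 1) + int (2 * n + 1)" by simp
    thus ?thesis by (simp only: power_int_add[OF disjI1[OF that]] power_int_of_nat)
  qed
  have nz: "\<alpha> \<noteq> 0" "\<beta> \<noteq> 0" using \<alpha>_pos \<beta>_neg by auto
  let ?a = "\<lambda>n. \<alpha> powi (s - 1) * ((-1) ^ n * \<alpha> ^ (2 * n + 1) / d n)"
  let ?b = "\<lambda>n. \<beta> powi (s - 1) * ((-1) ^ n * (- \<beta>) ^ (2 * n + 1) / d n)"
  have "(-1) ^ n * Lucas (2 * int n + s) / d n = ?a n - ?b n" for n
    unfolding Lucas_def powi[OF nz(1)] powi[OF nz(2)]
    by (simp add: distrib_left add_divide_distrib mult_ac)
  moreover have "(\<lambda>n. ?a n - ?b n) sums (\<alpha> powi (s - 1) * P - \<beta> powi (s - 1) * Q)"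
    by (intro sums_diff sums_mult assms)
  ultimately show "(\<lambda>n. (-1) ^ n * Lucas (2 * int n + s) / d n) sums (\<alpha> powi (s - 1) * P - \<beta> powi (s - 1) * Q)"
    by (simp only:)
  have "(-1) ^ n * Fibonacci (2 * int n + s) / d n = (?a n + ?b n) / sqrt 5" for n
    unfolding Fibonacci_def powi[OF nz(1)] powi[OF nz(2)]
    by (simp add: right_diff_distrib diff_divide_distrib mult_ac)
  moreover have "(\<lambda>n. (?a n + ?b n) / sqrt 5) sums ((\<alpha> powi (s - 1) * P + \<beta> powi (s - 1) * Q) / sqrt 5)"
    by (intro sums_divide sums_add sums_mult assms)
  ultimately show "(\<lambda>n. (-1) ^ n * Fibonacci (2 * int n + s) / d n) sums ((\<alpha> powi (s - 1) * P + \<beta> powi (s - 1) * Q) / sqrt 5)"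
    by (simp only:)
qed

lemma sums_of_real_eqI:
  assumes "f sums c" "S = of_real c"
  shows "(\<lambda>n. of_real (f n) :: 'a :: real_normed_div_algebra) sums S"
  using assms by (simp add: sums_of_real_iff)

section \<open>Specialization to the golden ratio\<close>

theorem theorem12:
  fixes s :: int and A :: real and B :: complex
  assumes A: "A = sqrt ((sqrt (70 + 2 * sqrt 5) - 8) / (1 + sqrt 5))"
    and B: "B = csqrt (complex_of_real ((sqrt (70 - 2 * sqrt 5) - 8) / (1 - sqrt 5)))"
  shows
    "(\<lambda>n. complex_of_real ((-1) ^ n * Lucas (2 * int n + s) / ((2 * real n + 1)\<^sup>2 * real ((4 * n + 2) choose (2 * n + 1)))))
       sums (4 * (complex_of_real (\<alpha> powi (s - 1) * arctan A * artanh A)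
           + complex_of_real \<beta> powi (s - 1) * Arctan B * artanh B)) \<and>
     (\<lambda>n. complex_of_real ((-1) ^ n * Fibonacci (2 * int n + s) / ((2 * real n + 1)\<^sup>2 * real ((4 * n + 2) choose (2 * n + 1)))))
       sums (4 / complex_of_real (sqrt 5) *
          (complex_of_real (\<alpha> powi (s - 1) * arctan A * artanh A)
           - complex_of_real \<beta> powi (s - 1) * Arctan B * artanh B)) \<and>
     (\<lambda>n. complex_of_real ((-1) ^ n * Lucas (2 * int n + s) / ((2 * real n + 1) * real ((4 * n + 2) choose (2 * n + 1)))))
       sums (complex_of_real (
             2 * A * \<alpha> powi (s - 1) * ((1 - A ^ 4) / (1 + A ^ 4))
             * (artanh A / (1 + A\<^sup>2) + arctan A / (1 - A\<^sup>2)))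
         + 2 * B * complex_of_real \<beta> powi (s - 1) * ((1 - B ^ 4) / (1 + B ^ 4))
             * (artanh B / (1 + B\<^sup>2) + Arctan B / (1 - B\<^sup>2))) \<and>
     (\<lambda>n. complex_of_real ((-1) ^ n * Fibonacci (2 * int n + s) / ((2 * real n + 1) * real ((4 * n + 2) choose (2 * n + 1)))))
       sums (complex_of_real (
             2 * A * \<alpha> powi (s - 1) / sqrt 5 * ((1 - A ^ 4) / (1 + A ^ 4))
             * (artanh A / (1 + A\<^sup>2) + arctan A / (1 - A\<^sup>2)))
         - 2 * B * complex_of_real \<beta> powi (s - 1) / complex_of_real (sqrt 5) * ((1 - B ^ 4) / (1 + B ^ 4))
             * (artanh B / (1 + B\<^sup>2) + Arctan B / (1 - B\<^sup>2))) \<and>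
     (\<lambda>n. complex_of_real ((-1) ^ n * Lucas (2 * int n + s) / real ((4 * n + 2) choose (2 * n + 1))))
       sums (complex_of_real (2 * A\<^sup>2 * (1 - A ^ 4) / (1 + A ^ 4)\<^sup>2 * \<alpha> powi (s - 1))
         + 2 * B\<^sup>2 * (1 - B ^ 4) / (1 + B ^ 4)\<^sup>2 * complex_of_real \<beta> powi (s - 1)
         + complex_of_real (A * \<alpha> powi (s - 1) * ((1 + A\<^sup>2) * (1 - A\<^sup>2)\<^sup>2 * (A ^ 4 + 4 * A\<^sup>2 + 1)
             / (1 + A ^ 4) ^ 3) * arctan A)
         + B * complex_of_real \<beta> powi (s - 1) * ((1 + B\<^sup>2) * (1 - B\<^sup>2)\<^sup>2 * (B ^ 4 + 4 * B\<^sup>2 + 1)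
             / (1 + B ^ 4) ^ 3) * Arctan B
         + complex_of_real (A * \<alpha> powi (s - 1) * ((1 - A\<^sup>2) * (1 + A\<^sup>2)\<^sup>2 * (A ^ 4 - 4 * A\<^sup>2 + 1)
             / (1 + A ^ 4) ^ 3) * artanh A)
         + B * complex_of_real \<beta> powi (s - 1) * ((1 - B\<^sup>2) * (1 + B\<^sup>2)\<^sup>2 * (B ^ 4 - 4 * B\<^sup>2 + 1)
             / (1 + B ^ 4) ^ 3) * artanh B) \<and>
     summable (\<lambda>n. (-1) ^ n * Fibonacci (2 * int n + s) / real ((4 * n + 2) choose (2 * n + 1))) \<and>
     complex_of_real (sqrt 5 * (\<Sum>n. (-1) ^ n * Fibonacci (2 * int n + s) / real ((4 * n + 2) choose (2 * n + 1))))
       = complex_of_real (2 * A\<^sup>2 * (1 - A ^ 4) / (1 + A ^ 4)\<^sup>2 * \<alpha> powi (s - 1))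
         - 2 * B\<^sup>2 * (1 - B ^ 4) / (1 + B ^ 4)\<^sup>2 * complex_of_real \<beta> powi (s - 1)
         + complex_of_real (A * \<alpha> powi (s - 1) * ((1 + A\<^sup>2) * (1 - A\<^sup>2)\<^sup>2 * (A ^ 4 + 4 * A\<^sup>2 + 1)
             / (1 + A ^ 4) ^ 3) * arctan A)
         - B * complex_of_real \<beta> powi (s - 1) * ((1 + B\<^sup>2) * (1 - B\<^sup>2)\<^sup>2 * (B ^ 4 + 4 * B\<^sup>2 + 1)
             / (1 + B ^ 4) ^ 3) * Arctan B
         + complex_of_real (A * \<alpha> powi (s - 1) * ((1 - A\<^sup>2) * (1 + A\<^sup>2)\<^sup>2 * (A ^ 4 - 4 * A\<^sup>2 + 1)
             / (1 + A ^ 4) ^ 3) * artanh A)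
         - B * complex_of_real \<beta> powi (s - 1) * ((1 - B\<^sup>2) * (1 + B\<^sup>2)\<^sup>2 * (B ^ 4 - 4 * B\<^sup>2 + 1)
             / (1 + B ^ 4) ^ 3) * artanh B"
proof -
  \<comment> \<open>The radicand of \<open>B\<close> is nonpositive, so its principal root is i
    times the real root of the absolute value.\<close>
  define b where "b = sqrt \<bar>(sqrt (70 - 2 * sqrt 5) - 8) / (1 - sqrt 5)\<bar>"
  have s5: "sqrt 5 > (2 :: real)" "sqrt 5 < (3 :: real)"
    by (auto intro!: real_less_rsqrt real_less_lsqrt)
  have neg: "(sqrt (70 - 2 * sqrt 5) - 8) / (1 - sqrt 5) \<le> 0"
    using s5 by (intro divide_nonneg_neg) (auto intro!: real_le_rsqrt)
  have Bb: "B = \<i> * of_real b"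
    unfolding B b_def using neg by (subst csqrt_of_real_nonpos) auto
  have "b = sqrt ((sqrt (70 - 2 * sqrt 5) - 8) / (sqrt 5 - 1))"
    unfolding b_def abs_of_nonpos[OF neg] minus_divide_right by simp
  \<comment> \<open>From 4 \<beta>^2 = 6 - 2 sqrt 5, the radicand takes the form of
    \<open>quadratic_parameter\<close> at z = -\<beta>; similarly for \<alpha> below.\<close>
  moreover have "70 - 2 * sqrt 5 = 64 + 4 * (- \<beta>) ^ 2" "sqrt 5 - 1 = 2 * (- \<beta>)"
    by (simp_all add: \<beta>_def power2_eq_square field_simps)
  ultimately have b: "b = sqrt ((sqrt (64 + 4 * (- \<beta>) ^ 2) - 8) / (2 * (- \<beta>)))" by (simp only:)
  have a: "A = sqrt ((sqrt (64 + 4 * \<alpha> ^ 2) - 8) / (2 * \<alpha>))"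
  proof -
    have "70 + 2 * sqrt 5 = 64 + 4 * \<alpha> ^ 2" "1 + sqrt 5 = 2 * \<alpha>"
      by (simp_all add: \<alpha>_def power2_eq_square field_simps)
    thus ?thesis unfolding A by (simp only:)
  qed
  have "- \<beta> > 0" using \<beta>_neg by simp
  note qA = quadratic_parameter[OF \<alpha>_pos a] and qb = quadratic_parameter[OF this b]
  have \<alpha>4: "\<alpha> < 4" and \<beta>4: "- \<beta> < 4" using s5 by (simp_all add: \<alpha>_def \<beta>_def field_simps)
  note SA = alternating_odd_central_binomial_sums[OF qA \<alpha>4]
    and Sb = alternating_odd_central_binomial_sums[OF qb \<beta>4]
  note LF1 = Lucas_Fibonacci_sums[OF SA(1) Sb(1), of s]
    and LF2 = Lucas_Fibonacci_sums[OF SA(2) Sb(2), of s]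
    and LF3 = Lucas_Fibonacci_sums[OF SA(3) Sb(3), of s]
  have sq: "B ^ 2 = - of_real (b ^ 2)" "B ^ 4 = of_real (b ^ 4)"
    by (simp_all add: Bb power_mult_distrib)
  have fn: "Arctan B = \<i> * of_real (artanh b)" "artanh B = \<i> * of_real (arctan b)"
    unfolding Bb using Arctan_i_times[of b] qb artanh_i_times[of b] by simp_all
  \<comment> \<open>The factorization 1 - x^4 = (1 - x^2)(1 + x^2) clears the inner denominators of
    the stated formula.\<close>
  have third: "2 * x * k * ((1 - x ^ 4) / (1 + x ^ 4)) * (artanh x / (1 + x ^ 2) + arctan x / (1 - x ^ 2)) =
       k * (2 * x * ((1 - x ^ 2) * artanh x + (1 + x ^ 2) * arctan x) / (1 + x ^ 4))"
    if "0 < x" "x < 1" for x k :: real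
  proof -
    have "1 + x ^ 2 > 0" "1 - x ^ 2 > 0" "1 + x ^ 4 > 0"
      using that by (auto simp: add_pos_pos power_less_one_iff)
    moreover have "1 - x ^ 4 = (1 - x ^ 2) * (1 + x ^ 2)" by algebra
    ultimately show ?thesis by (simp add: divide_simps)
  qed
  \<comment> \<open>In \<open>B1\<close>, \<open>B2\<close> and \<open>B3\<close> two factors i, or
    B^2 = -b^2, give a minus sign, which matches the sign of the \<beta> part in
    \<open>Lucas_Fibonacci_sums\<close>.\<close>
  have B1: "Arctan B * artanh B = - of_real (arctan b * artanh b)"
    unfolding fn by (simp add: complex_eq_iff)
  have B2: "2 * B * of_real k * ((1 - B ^ 4) / (1 + B ^ 4)) * (artanh B / (1 + B\<^sup>2) + Arctan B / (1 - B\<^sup>2)) =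
      - of_real (k * (2 * b * ((1 - b ^ 2) * artanh b + (1 + b ^ 2) * arctan b) / (1 + b ^ 4)))" for k
  proof -
    have "2 * B * of_real k = \<i> * of_real (2 * b * k)" by (simp add: Bb)
    moreover have "(1 - B ^ 4) / (1 + B ^ 4) = of_real ((1 - b ^ 4) / (1 + b ^ 4))" by (simp add: sq)
    moreover have "artanh B / (1 + B\<^sup>2) + Arctan B / (1 - B\<^sup>2) =
        \<i> * of_real (artanh b / (1 + b ^ 2) + arctan b / (1 - b ^ 2))"
      by (simp add: sq fn distrib_left)
    moreover have "\<i> * of_real x * of_real y * (\<i> * of_real z) = - of_real (x * y * z)" for x y z
      by (simp add: complex_eq_iff)
    ultimately have "2 * B * of_real k * ((1 - B ^ 4) / (1 + B ^ 4)) * (artanh B / (1 + B\<^sup>2) + Arctan B / (1 - B\<^sup>2)) =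
      - of_real (2 * b * k * ((1 - b ^ 4) / (1 + b ^ 4)) * (artanh b / (1 + b ^ 2) + arctan b / (1 - b ^ 2)))"
      by (simp only:)
    thus ?thesis unfolding third[OF qb(1,2)] .
  qed
  have B3: "2 * B\<^sup>2 * (1 - B ^ 4) / (1 + B ^ 4)\<^sup>2 * of_real k
       + (B * of_real k * ((1 + B\<^sup>2) * (1 - B\<^sup>2)\<^sup>2 * (B ^ 4 + 4 * B\<^sup>2 + 1) / (1 + B ^ 4) ^ 3) * Arctan B
       + B * of_real k * ((1 - B\<^sup>2) * (1 + B\<^sup>2)\<^sup>2 * (B ^ 4 - 4 * B\<^sup>2 + 1) / (1 + B ^ 4) ^ 3) * artanh B) =
     - of_real (k * (2 * b ^ 2 * (1 - b ^ 4) / (1 + b ^ 4) ^ 2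
             + b * ((1 + b ^ 2) * (1 - b ^ 2) ^ 2 * (b ^ 4 + 4 * b ^ 2 + 1) / (1 + b ^ 4) ^ 3) * arctan b
             + b * ((1 - b ^ 2) * (1 + b ^ 2) ^ 2 * (b ^ 4 - 4 * b ^ 2 + 1) / (1 + b ^ 4) ^ 3) * artanh b))" for k
  proof -
    \<comment> \<open>Replacing B^2 by -b^2 interchanges the two large fractions, while
      \<open>fn\<close> interchanges the inverse functions, so each fraction still meets its own
      function.\<close>
    have *: "2 * B\<^sup>2 * (1 - B ^ 4) / (1 + B ^ 4)\<^sup>2 = - of_real (2 * b ^ 2 * (1 - b ^ 4) / (1 + b ^ 4) ^ 2)"
      "(1 + B\<^sup>2) * (1 - B\<^sup>2)\<^sup>2 * (B ^ 4 + 4 * B\<^sup>2 + 1) / (1 + B ^ 4) ^ 3 =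
         of_real ((1 - b ^ 2) * (1 + b ^ 2) ^ 2 * (b ^ 4 - 4 * b ^ 2 + 1) / (1 + b ^ 4) ^ 3)"
      "(1 - B\<^sup>2) * (1 + B\<^sup>2)\<^sup>2 * (B ^ 4 - 4 * B\<^sup>2 + 1) / (1 + B ^ 4) ^ 3 =
         of_real ((1 + b ^ 2) * (1 - b ^ 2) ^ 2 * (b ^ 4 + 4 * b ^ 2 + 1) / (1 + b ^ 4) ^ 3)"
      by (simp_all add: sq)
    have "B * of_real k * of_real x * (\<i> * of_real y) = - of_real (k * (b * x * y))" for x y
      by (simp add: Bb complex_eq_iff)
    thus ?thesis unfolding * fn by (simp only: distrib_left of_real_add of_real_mult) (simp add: algebra_simps)
  qed
  \<comment> \<open>The stated formulas interleave \<open>A\<close> and \<open>B\<close> terms; this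
    regroups them into the two real blocks, with either sign of the \<open>B\<close> block.\<close>
  have combine: "of_real x1 + X1 + of_real x2 + X2 + of_real x3 + X3 = of_real (k * (y1 + y2 + y3) - l * z)"
      "of_real (sqrt 5 * ((k * (y1 + y2 + y3) + l * z) / sqrt 5)) = of_real x1 - X1 + of_real x2 - X2 + of_real x3 - X3"
    if X: "X1 + (X2 + X3) = - of_real (l * z)" and x: "x1 = k * y1" "x2 = k * y2" "x3 = k * y3"
    for x1 x2 x3 y1 y2 y3 z k l :: real and X1 X2 X3 :: complex
  proof -
    have W: "x1 + x2 + x3 = k * (y1 + y2 + y3)"
      by (simp add: x distrib_left)
    have "of_real x1 + X1 + of_real x2 + X2 + of_real x3 + X3 = of_real (x1 + x2 + x3) + (X1 + (X2 + X3))"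
      by simp
    also have "\<dots> = of_real (k * (y1 + y2 + y3) - l * z)"
      unfolding X W by simp
    finally show "of_real x1 + X1 + of_real x2 + X2 + of_real x3 + X3 = of_real (k * (y1 + y2 + y3) - l * z)" .
    have "of_real (sqrt 5 * ((k * (y1 + y2 + y3) + l * z) / sqrt 5)) = of_real (x1 + x2 + x3) - (X1 + (X2 + X3))"
      unfolding X W by simp
    also have "\<dots> = of_real x1 - X1 + of_real x2 - X2 + of_real x3 - X3"
      by (simp add: algebra_simps)
    finally show "of_real (sqrt 5 * ((k * (y1 + y2 + y3) + l * z) / sqrt 5)) =
      of_real x1 - X1 + of_real x2 - X2 + of_real x3 - X3" .
  qed
  have k\<beta>: "of_real \<beta> powi (s - 1) = (of_real (\<beta> powi (s - 1)) :: complex)"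
    by simp
  \<comment> \<open>Cases 1 to 5 are the equations between the stated and computed limits. The last
    Fibonacci formula is stated as summability and a value, which are cases 6 and 7.\<close>
  show ?thesis
    unfolding k\<beta>
  proof (intro conjI sums_of_real_eqI[OF LF1(1)] sums_of_real_eqI[OF LF1(2)] sums_of_real_eqI[OF LF2(1)]
      sums_of_real_eqI[OF LF2(2)] sums_of_real_eqI[OF LF3(1)], goal_cases)
    case 1
    show ?case unfolding mult.assoc[of _ "Arctan B"] B1 by (simp add: algebra_simps)
  next
    case 2
    show ?case unfolding mult.assoc[of _ "Arctan B"] B1 by (simp add: algebra_simps add_divide_distrib)
  next
    case 3
    show ?case unfolding third[OF qA(1,2)] B2 by simp
  next
    case 4
    \<comment> \<open>Moving sqrt 5 into the free factor \<open>k\<close> lets \<open>third\<close>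
      and \<open>B2\<close> apply as in the Lucas case.\<close>
    have "2 * A * \<alpha> powi (s - 1) / sqrt 5 = 2 * A * (\<alpha> powi (s - 1) / sqrt 5)"
      "2 * B * of_real (\<beta> powi (s - 1)) / of_real (sqrt 5) = 2 * B * of_real (\<beta> powi (s - 1) / sqrt 5)"
      by simp_all
    thus ?case
      by (simp only: third[OF qA(1,2)] B2) (simp add: add_divide_distrib mult_ac)
  next
    case 5
    show ?case by (rule combine(1)[OF B3]) simp_all
  next
    case 6
    show ?case using LF3(2) by (rule sums_summable)
  next
    case 7
    show ?case unfolding sums_unique[OF LF3(2), symmetric] by (rule combine(2)[OF B3]) simp_all
  qed
qed

end
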